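(* Let $T_{n,2}$ be the welded knot diagram obtained from the standard diagram of the twist knot $T_n$ by welding two crossings of the twist region having exactly one classical crossing in between, and let $G(T_{n,2})$ be its knot group. Then $G(T_{n,2})\not\cong\mathbb{Z}$ when $n$ is odd.
   Context: A virtual knot diagram is the image of a generic immersion $S^1\to\mathbb{R}^2$ with finitely many transverse double points, each marked either as a classical crossing (with over/under information) or as a virtual (also called welded) crossing. A welded knot is an equivalence class of virtual knot diagrams under planar isotopy and finite sequences of: the classical Reidemeister moves; the virtual Reidemeister moves $vR_1,vR_2,vR_3$ (analogues of the Reidemeister moves with all crossings virtual); $vR_4$ (a strand having two consecutive virtual crossings is slid across a classical crossing); and the over-forbidden move $F_o$ (a strand that is the over-strand at two consecutive classical crossings is slid across a virtual crossing of the two other strands). Welding a classical crossing means replacing it by a virtual (welded) crossing. The knot group (fundamental group) $G(K)$ of a welded knot $K$ is given by the Wirtinger presentation of any of its oriented diagrams: the generators are the arcs, an arc being the part of the diagram between two consecutive under-crossings (arcs continue through virtual crossings); each classical crossing with over-arc $y$ and under-arcs $x_r$ (on the right of the oriented over-arc) and $x_l$ (on its left) gives the relation $x_l=y\,x_r\,y^{-1}$; virtual crossings give no relation. (The opposite conjugation convention yields an isomorphic group.) The standard diagram of the twist knot $T_n$ is the alternating diagram with $n+2$ classical crossings consisting of a twist region of $n$ consecutive half-twists (crossings) $c_1,\dots,c_n$ of two strands, closed up by a clasp with two crossings. In $T_{n,2}$ the two welded crossings lie at one end of the twist region: they are $c_{n-2}$ and $c_n$, while $c_{n-1}$ and all other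 crossings stay classical.
   Formalization: The claim is proved for odd n at least 5: for n = 1 the two crossings to be welded do not exist, and for n = 3 the claim is false, since the knot group of the welded diagram (first and third twist crossings welded) is infinite cyclic. *)

theory Defs
  imports "HOL-Algebra.Elementary_Groups"
begin

section \<open>Groups given by generators and relations\<close>

text \<open>The letter \<open>(x, True)\<close> stands for the generator \<open>x\<close>, the letter \<open>(x, False)\<close> for its
  inverse. A pair \<open>(u, v)\<close> of words in the relation set stands for the relation \<open>u = v\<close>.\<close>

type_synonym 'g word = "('g \<times> bool) list"

definition words :: "'g set \<Rightarrow> 'g word set"
  where "words X = lists (X \<times> UNIV)"

inductive word_eq :: "'g set \<Rightarrow> ('g word \<times> 'g word) set \<Rightarrow> 'g word \<Rightarrow> 'g word \<Rightarrow> bool"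
  for X R where
  refl: "w \<in> words X \<Longrightarrow> word_eq X R w w"
| sym: "word_eq X R u v \<Longrightarrow> word_eq X R v u"
| trans: "word_eq X R u v \<Longrightarrow> word_eq X R v w \<Longrightarrow> word_eq X R u w"
| append: "word_eq X R u u' \<Longrightarrow> word_eq X R v v' \<Longrightarrow> word_eq X R (u @ v) (u' @ v')"
| cancel: "x \<in> X \<Longrightarrow> word_eq X R [(x, b), (x, \<not> b)] []"
| rel: "(u, v) \<in> R \<Longrightarrow> u \<in> words X \<Longrightarrow> v \<in> words X \<Longrightarrow> word_eq X R u v"

definition word_rel :: "'g set \<Rightarrow> ('g word \<times> 'g word) set \<Rightarrow> ('g word \<times> 'g word) set"
  where "word_rel X R = {(u, v). word_eq X R u v}"

definition presented_group :: "'g set \<Rightarrow> ('g word \<times> 'g word) set \<Rightarrow> 'g word set monoid"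
  where "presented_group X R =
    \<lparr>carrier = words X // word_rel X R,
     monoid.mult = (\<lambda>A B. \<Union>u\<in>A. \<Union>v\<in>B. word_rel X R `` {u @ v}),
     one = word_rel X R `` {[]}\<rparr>"


section \<open>Oriented virtual knot diagrams and their Wirtinger groups\<close>

text \<open>A diagram is recorded by its crossings and the oriented edges (the pieces of the curve
  between consecutive double points, classical or virtual) meeting there. The flag \<open>positive\<close>
  says that the under-strand crosses the oriented over-strand from right to left; together with
  the four edges it determines their cyclic order around the crossing. At a virtual crossing
  only this cyclic order is meaningful: which of the two strands is called ``over'' is
  then irrelevant, and the group below ignores it.\<close>

record 'e crossing =
  over_in :: 'e
  over_out :: 'e
  under_in :: 'e
  under_out :: 'e
  positive :: bool

record ('c, 'e) diagram =
  crossings :: "'c set"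
  virtual :: "'c set"
  strands :: "'c \<Rightarrow> 'e crossing"

definition classical :: "('c, 'e) diagram \<Rightarrow> 'c set"
  where "classical D = crossings D - virtual D"

definition weld :: "'c set \<Rightarrow> ('c, 'e) diagram \<Rightarrow> ('c, 'e) diagram"
  where "weld W D = D\<lparr>virtual := virtual D \<union> W\<rparr>"

definition switch :: "'e crossing \<Rightarrow> 'e crossing"
  where "switch x = \<lparr>over_in = under_in x, over_out = under_out x,
    under_in = over_in x, under_out = over_out x, positive = (\<not> positive x)\<rparr>"

definition mirror_image :: "('c, 'e) diagram \<Rightarrow> ('c, 'e) diagram"
  where "mirror_image D = D\<lparr>strands := switch \<circ> strands D\<rparr>"

definition edges :: "('c, 'e) diagram \<Rightarrow> 'e set"
  where "edges D = (\<Union>c\<in>crossings D. {over_in (strands D c), over_out (strands D c),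
    under_in (strands D c), under_out (strands D c)})"

text \<open>Arcs run through over-crossings and through both strands of virtual crossings; they end
  only at classical under-crossings.\<close>

definition joined :: "('c, 'e) diagram \<Rightarrow> ('e \<times> 'e) set"
  where "joined D =
    {(over_in (strands D c), over_out (strands D c)) | c. c \<in> crossings D} \<union>
    {(under_in (strands D c), under_out (strands D c)) | c. c \<in> crossings D \<inter> virtual D}"

definition arc_rel :: "('c, 'e) diagram \<Rightarrow> ('e \<times> 'e) set"
  where "arc_rel D = (joined D \<union> (joined D)\<inverse>)\<^sup>*"

definition arc_of :: "('c, 'e) diagram \<Rightarrow> 'e \<Rightarrow> 'e set"
  where "arc_of D e = arc_rel D `` {e}"

definition arcs :: "('c, 'e) diagram \<Rightarrow> 'e set set"
  where "arcs D = edges D // arc_rel D"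

definition right_under :: "'e crossing \<Rightarrow> 'e"
  where "right_under x = (if positive x then under_in x else under_out x)"

definition left_under :: "'e crossing \<Rightarrow> 'e"
  where "left_under x = (if positive x then under_out x else under_in x)"

definition wirtinger_relation :: "('c, 'e) diagram \<Rightarrow> 'c \<Rightarrow> 'e set word \<times> 'e set word"
  where "wirtinger_relation D c =
    (let y = arc_of D (over_in (strands D c));
         xr = arc_of D (right_under (strands D c));
         xl = arc_of D (left_under (strands D c))
     in ([(xl, True)], [(y, True), (xr, True), (y, False)]))"

definition knot_group :: "('c, 'e) diagram \<Rightarrow> 'e set word set monoid"
  where "knot_group D = presented_group (arcs D) (wirtinger_relation D ` classical D)"


section \<open>Twist knots\<close>

text \<open>The twist region is drawn horizontally, with crossings \<open>Twist 1, ..., Twist n\<close> from left to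
  right; \<open>Top i\<close> and \<open>Bot i\<close> are the upper and lower edge immediately to the right of \<open>Twist i\<close>
  (for \<open>i = 0\<close>: to the left of \<open>Twist 1\<close>). Both pairs of ends are bent upwards, so that the top
  edges become the inner and the bottom edges the outer legs of two hooks, which clasp above the
  twist region. \<open>Left_Tip\<close> and \<open>Right_Tip\<close> are the tips of the left and of the right hook:

  \<^item> at \<open>Upper_Clasp\<close> the edges \<open>Bot 0\<close>, \<open>Left_Tip\<close> of the left hook cross the edges \<open>Bot n\<close>,
    \<open>Right_Tip\<close> of the right hook;
  \<^item> at \<open>Lower_Clasp\<close> the edges \<open>Left_Tip\<close>, \<open>Top 0\<close> of the left hook cross the edges
    \<open>Right_Tip\<close>, \<open>Top n\<close> of the right hook.

  The knot is oriented such that the left hook is traversed from \<open>Bot 0\<close> to \<open>Top 0\<close>. The strand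
  starting at \<open>Top 0\<close> then runs through the twist region from left to right, leaving it at
  \<open>Bot n\<close> if \<open>n\<close> is odd and at \<open>Top n\<close> if \<open>n\<close> is even; this decides the direction in which
  the right hook is traversed. In all twist crossings the strand between upper left and lower
  right is the over-strand. The left hook is over at \<open>Upper_Clasp\<close> and under at
  \<open>Lower_Clasp\<close>, which makes the diagram alternating.\<close>

datatype twist_crossing = Twist nat | Upper_Clasp | Lower_Clasp

datatype twist_edge = Top nat | Bot nat | Left_Tip | Right_Tip

fun twist_strands :: "nat \<Rightarrow> twist_crossing \<Rightarrow> twist_edge crossing" where
  "twist_strands n (Twist i) =
    (if odd i
     then \<lparr>over_in = Top (i - 1), over_out = Bot i,
           under_in = Top i, under_out = Bot (i - 1), positive = False\<rparr>
     else \<lparr>over_in = Bot i, over_out = Top (i - 1),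
           under_in = Bot (i - 1), under_out = Top i, positive = False\<rparr>)"
| "twist_strands n Upper_Clasp =
    (if odd n
     then \<lparr>over_in = Bot 0, over_out = Left_Tip,
           under_in = Bot n, under_out = Right_Tip, positive = False\<rparr>
     else \<lparr>over_in = Bot 0, over_out = Left_Tip,
           under_in = Right_Tip, under_out = Bot n, positive = True\<rparr>)"
| "twist_strands n Lower_Clasp =
    (if odd n
     then \<lparr>over_in = Right_Tip, over_out = Top n,
           under_in = Left_Tip, under_out = Top 0, positive = False\<rparr>
     else \<lparr>over_in = Top n, over_out = Right_Tip,
           under_in = Left_Tip, under_out = Top 0, positive = True\<rparr>)"

definition twist_diagram :: "nat \<Rightarrow> (twist_crossing, twist_edge) diagram"
  where "twist_diagram n =
    \<lparr>crossings = Twist ` {1..n} \<union> {Upper_Clasp, Lower_Clasp},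
     virtual = {},
     strands = twist_strands n\<rparr>"

text \<open>``The'' standard diagram is determined up to its chirality. The two chiralities have to be
  distinguished here because the group of a virtual diagram may change when all classical
  crossings are switched. Exchanging the two ends of the twist region amounts to switching the
  chirality (look at the diagram from behind).\<close>

definition standard_twist_diagrams :: "nat \<Rightarrow> (twist_crossing, twist_edge) diagram set"
  where "standard_twist_diagrams n = {twist_diagram n, mirror_image (twist_diagram n)}"


section \<open>The case of three half-twists\<close>

lemma word_eq_in_words: "word_eq X R u v \<Longrightarrow> u \<in> words X \<and> v \<in> words X"
  by (induction rule: word_eq.induct) (auto simp: words_def)

lemma equiv_word_rel: "equiv (words X) (word_rel X R)"
  by (rule equivI)
    (auto simp: refl_on_def sym_def trans_def word_rel_def
      dest: word_eq_in_words intro: word_eq.intros)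

definition exp_sum :: "'g word \<Rightarrow> int"
  where "exp_sum w = (\<Sum>(x, b)\<leftarrow>w. if b then 1 else - 1)"

lemma exp_sum_simps [simp]:
  "exp_sum [] = 0" "exp_sum ((x, b) # w) = (if b then 1 else - 1) + exp_sum w"
  "exp_sum (u @ v) = exp_sum u + exp_sum v"
  by (auto simp: exp_sum_def)

lemma word_eq_exp_sum:
  assumes "word_eq X R u v" "\<And>u v. (u, v) \<in> R \<Longrightarrow> exp_sum u = exp_sum v"
  shows "exp_sum u = exp_sum v"
  using assms by (induction rule: word_eq.induct) auto

definition pow_word :: "'g \<Rightarrow> int \<Rightarrow> 'g word"
  where "pow_word g k = replicate (nat \<bar>k\<bar>) (g, k \<ge> 0)"

lemma exp_sum_pow_word [simp]: "exp_sum (pow_word g k) = k"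
proof -
  have "exp_sum (replicate m (g, b)) = (if b then int m else - int m)" for m b
    by (induction m) auto
  then show ?thesis by (auto simp: pow_word_def)
qed

lemma pow_word_in_words: "g \<in> X \<Longrightarrow> pow_word g k \<in> words X"
  by (auto simp: pow_word_def words_def)

lemma word_eq_inverse_letter:
  assumes "word_eq X R [(x, True)] [(y, True)]"
  shows "word_eq X R [(x, False)] [(y, False)]"
proof -
  have X: "x \<in> X" "y \<in> X"
    using word_eq_in_words[OF assms] by (auto simp: words_def)
  have r: "word_eq X R [(z, b)] [(z, b)]" if "z \<in> X" for z b
    using that by (auto intro: word_eq.refl simp: words_def)
  have "word_eq X R ([(x, False)] @ [(y, True), (y, False)]) ([(x, False)] @ [])"
    using word_eq.cancel[of y X R True] X by (intro word_eq.append r) auto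
  moreover have "word_eq X R (([(x, False)] @ [(x, True)]) @ [(y, False)])
      (([(x, False)] @ [(y, True)]) @ [(y, False)])"
    using X assms by (intro word_eq.append r) auto
  moreover have "word_eq X R ([(x, False), (x, True)] @ [(y, False)]) ([] @ [(y, False)])"
    using word_eq.cancel[of x X R False] X by (intro word_eq.append r) auto
  ultimately show ?thesis
    by simp (meson word_eq.sym word_eq.trans)
qed

lemma word_eq_letter_pow_word:
  assumes "g \<in> X"
  shows "word_eq X R ((g, b) # pow_word g k) (pow_word g (k + (if b then 1 else - 1)))"
proof -
  have w: "pow_word g l \<in> words X" for l
    using assms by (rule pow_word_in_words)
  have c: "word_eq X R ((g, b) # (g, \<not> b) # pow_word g l) (pow_word g l)" for l
    using word_eq.append[OF word_eq.cancel[OF assms] word_eq.refl[OF w]] by simp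
  have pos: "pow_word g (l + 1) = (g, True) # pow_word g l" if "l \<ge> 0" for l
    using that by (simp add: pow_word_def nat_add_distrib)
  have neg: "pow_word g (l - 1) = (g, False) # pow_word g l" if "l \<le> 0" for l
  proof -
    from that have "nat \<bar>l - 1\<bar> = Suc (nat \<bar>l\<bar>)" by simp
    with that show ?thesis by (cases "l = 0") (simp_all add: pow_word_def)
  qed
  show ?thesis
  proof (cases b)
    case True
    show ?thesis
    proof (cases "k \<ge> 0")
      case True
      with \<open>b\<close> show ?thesis using pos[of k] word_eq.refl[OF w, of R "k + 1"] by simp
    next
      case False
      with \<open>b\<close> show ?thesis using neg[of "k + 1"] c[of "k + 1"] by simp
    qed
  next
    case b: False
    show ?thesis
    proof (cases "k \<le> 0")
      case True
      with b show ?thesis using neg[of k] word_eq.refl[OF w, of R "k - 1"] by simp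
    next
      case False
      with b show ?thesis using pos[of "k - 1"] c[of "k - 1"] by simp
    qed
  qed
qed

lemma presented_group_infinite_cyclic:
  assumes g: "g \<in> X"
    and X: "\<And>x. x \<in> X \<Longrightarrow> word_eq X R [(x, True)] [(g, True)]"
    and R: "\<And>u v. (u, v) \<in> R \<Longrightarrow> exp_sum u = exp_sum v"
  shows "presented_group X R \<cong> integer_group"
proof -
  let ?E = "word_rel X R"
  have pow: "word_eq X R w (pow_word g (exp_sum w))" if "w \<in> words X" for w
    using that
  proof (induction w)
    case Nil
    then show ?case by (auto simp: pow_word_def words_def intro: word_eq.refl)
  next
    case (Cons a w)
    obtain x b where a: "a = (x, b)" by fastforce
    from Cons a have xw: "x \<in> X" "w \<in> words X" by (auto simp: words_def)
    have "word_eq X R [(x, b)] [(g, b)]"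
      using X[OF xw(1)] by (cases b) (auto intro: word_eq_inverse_letter)
    from word_eq.append[OF this Cons.IH[OF xw(2)]]
    have "word_eq X R ((x, b) # w) ((g, b) # pow_word g (exp_sum w))" by simp
    from word_eq.trans[OF this word_eq_letter_pow_word[OF g]] show ?case
      by (simp add: a add.commute)
  qed
  have iff: "word_eq X R u v \<longleftrightarrow> exp_sum u = exp_sum v" if "u \<in> words X" "v \<in> words X" for u v
  proof
    assume "word_eq X R u v"
    then show "exp_sum u = exp_sum v" by (rule word_eq_exp_sum) (rule R)
  next
    assume "exp_sum u = exp_sum v"
    with pow[OF that(1)] have "word_eq X R u (pow_word g (exp_sum v))" by simp
    then show "word_eq X R u v" by (rule word_eq.trans) (rule word_eq.sym[OF pow[OF that(2)]])
  qed
  define h where "h = (\<lambda>A :: 'a word set. exp_sum (SOME w. w \<in> A))"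
  have h: "h (?E `` {w}) = exp_sum w" if "w \<in> words X" for w
  proof -
    have "w \<in> ?E `` {w}"
      using that by (auto simp: word_rel_def intro: word_eq.refl)
    then have "(SOME v. v \<in> ?E `` {w}) \<in> ?E `` {w}" by (rule someI)
    then have "word_eq X R w (SOME v. v \<in> ?E `` {w})" by (simp add: word_rel_def)
    then have "exp_sum w = exp_sum (SOME v. v \<in> ?E `` {w})"
      by (rule word_eq_exp_sum) (rule R)
    then show ?thesis by (simp add: h_def)
  qed
  have mult: "?E `` {u} \<otimes>\<^bsub>presented_group X R\<^esub> ?E `` {v} = ?E `` {u @ v}"
    if "u \<in> words X" "v \<in> words X" for u v
  proof -
    have "word_eq X R (u @ v) w"
      if "word_eq X R u u'" "word_eq X R v v'" "word_eq X R (u' @ v') w" for u' v' w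
      using word_eq.append[OF that(1,2)] that(3) by (rule word_eq.trans)
    moreover have "word_eq X R u u" "word_eq X R v v"
      using that by (auto intro: word_eq.refl)
    ultimately show ?thesis
      unfolding presented_group_def word_rel_def by simp blast
  qed
  have "h \<in> iso (presented_group X R) integer_group"
  proof (rule isoI)
    show "h \<in> hom (presented_group X R) integer_group"
    proof (rule homI)
      fix A B assume "A \<in> carrier (presented_group X R)" "B \<in> carrier (presented_group X R)"
      then obtain u v where uv: "u \<in> words X" "v \<in> words X" "A = ?E `` {u}" "B = ?E `` {v}"
        by (auto simp: presented_group_def elim!: quotientE)
      then have "u @ v \<in> words X" by (auto simp: words_def)
      with uv show "h (A \<otimes>\<^bsub>presented_group X R\<^esub> B) = h A \<otimes>\<^bsub>integer_group\<^esub> h B"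
        by (simp add: mult h)
    qed simp
    show "bij_betw h (carrier (presented_group X R)) (carrier integer_group)"
      unfolding bij_betw_def
    proof
      show "inj_on h (carrier (presented_group X R))"
      proof (rule inj_onI)
        fix A B assume "A \<in> carrier (presented_group X R)" "B \<in> carrier (presented_group X R)"
        then obtain u v where uv: "u \<in> words X" "v \<in> words X" "A = ?E `` {u}" "B = ?E `` {v}"
          by (auto simp: presented_group_def elim!: quotientE)
        assume "h A = h B"
        with uv have "exp_sum u = exp_sum v" by (simp add: h)
        with uv have "(u, v) \<in> ?E" by (simp add: iff word_rel_def)
        with uv show "A = B" by (simp add: equiv_class_eq[OF equiv_word_rel])
      qed
      have "k \<in> h ` carrier (presented_group X R)" for k
      proof (rule image_eqI)
        show "k = h (?E `` {pow_word g k})"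
          using g by (simp add: h pow_word_in_words)
        show "?E `` {pow_word g k} \<in> carrier (presented_group X R)"
          using g by (simp add: presented_group_def quotientI pow_word_in_words)
      qed
      then show "h ` carrier (presented_group X R) = carrier integer_group" by auto
    qed
  qed
  then show ?thesis by (rule is_isoI)
qed

lemma joined_arc_of_eq:
  assumes "(e, f) \<in> joined D"
  shows "arc_of D e = arc_of D f"
proof -
  have "equiv UNIV (arc_rel D)"
    unfolding arc_rel_def
    by (rule equivI) (auto simp: refl_on_def intro: sym_rtrancl sym_Un_converse trans_rtrancl)
  moreover have "(e, f) \<in> arc_rel D"
    using assms by (auto simp: arc_rel_def)
  ultimately show ?thesis unfolding arc_of_def by (rule equiv_class_eq)
qed

lemma word_eq_conjugate:
  assumes "x \<in> X" "y \<in> X" "z \<in> X"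
    and "([(x, True)], [(y, True), (z, True), (y, False)]) \<in> R"
    and "x = y \<or> z = y"
  shows "word_eq X R [(x, True)] [(z, True)]"
proof -
  have l: "word_eq X R w w" if "set w \<subseteq> X \<times> UNIV" for w
    using that by (auto simp: words_def intro!: word_eq.refl)
  have r: "word_eq X R [(x, True)] [(y, True), (z, True), (y, False)]"
    using assms by (intro word_eq.rel) (auto simp: words_def)
  from assms(5) show ?thesis
  proof
    assume "z = y"
    have "word_eq X R ([(y, True)] @ [(y, True), (y, False)]) ([(y, True)] @ [])"
      using assms word_eq.cancel[of y X R True] by (intro word_eq.append l) auto
    with r \<open>z = y\<close> show ?thesis by simp (meson word_eq.trans)
  next
    assume "x = y"
    have "word_eq X R ([(y, False)] @ [(y, True)] @ [(y, True)])
       ([(y, False)] @ [(y, True), (z, True), (y, False)] @ [(y, True)])"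
      using assms r \<open>x = y\<close> by (intro word_eq.append l) auto
    moreover have "word_eq X R ([(y, False), (y, True)] @ [(y, True)]) ([] @ [(y, True)])"
      using assms word_eq.cancel[of y X R False] by (intro word_eq.append l) auto
    moreover have "word_eq X R ([(y, False), (y, True)] @ [(z, True)] @ [(y, False), (y, True)])
        ([] @ [(z, True)] @ [])"
      using assms word_eq.cancel[of y X R False] by (intro word_eq.append l) auto
    ultimately show ?thesis
      using \<open>x = y\<close> by simp (meson word_eq.sym word_eq.trans)
  qed
qed

lemma exp_sum_wirtinger:
  "(u, v) \<in> wirtinger_relation D ` S \<Longrightarrow> exp_sum u = exp_sum v"
  by (auto simp: wirtinger_relation_def Let_def)

text \<open>For \<open>n = 3\<close>, welding the first and the third twist crossing gives a diagram in which a
  single arc contains all over-passes; its group is infinite cyclic.\<close>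

lemma knot_group_three_half_twists:
  assumes "T \<in> standard_twist_diagrams 3"
  shows "knot_group (weld {Twist 1, Twist 3} T) \<cong> integer_group"
proof -
  define D where "D = weld {Twist 1, Twist 3} T"
  define g where "g = arc_of D Left_Tip"
  let ?X = "arcs D" and ?R = "wirtinger_relation D ` classical D"
  have *: "{Suc 0..3} = {1, 2, 3}" by auto
  have T: "T = twist_diagram 3 \<or> T = mirror_image (twist_diagram 3)"
    using assms by (simp add: standard_twist_diagrams_def)
  have cr: "crossings D = {Twist 1, Twist 2, Twist 3, Upper_Clasp, Lower_Clasp}"
    and vi: "virtual D = {Twist 1, Twist 3}"
    using T by (auto simp: D_def weld_def twist_diagram_def mirror_image_def *)
  have st: "strands D = twist_strands 3 \<or> strands D = switch \<circ> twist_strands 3"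
    using T by (auto simp: D_def weld_def twist_diagram_def mirror_image_def)
  have cl: "classical D = {Twist 2, Upper_Clasp, Lower_Clasp}"
    by (auto simp: classical_def cr vi)
  have X: "?X = arc_of D ` edges D"
    by (auto simp: arcs_def arc_of_def quotient_def)
  have ed: "edges D = {Top 0, Top (Suc 0), Top 2, Top 3, Bot 0, Bot (Suc 0), Bot 2, Bot 3,
      Left_Tip, Right_Tip}"
    using st by (auto simp: edges_def cr switch_def)
  have over: "arc_of D (over_in (strands D c)) = arc_of D (over_out (strands D c))"
    if "c \<in> crossings D" for c
    using that by (intro joined_arc_of_eq) (auto simp: joined_def)
  have under: "arc_of D (under_in (strands D c)) = arc_of D (under_out (strands D c))"
    if "c \<in> {Twist 1, Twist 3}" for c
    using that by (intro joined_arc_of_eq) (auto simp: joined_def cr vi)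
  have conj: "word_eq ?X ?R [(arc_of D (left_under (strands D c)), True)]
      [(arc_of D (right_under (strands D c)), True)]"
    if "c \<in> classical D" "arc_of D (over_in (strands D c)) \<in>
      {arc_of D (left_under (strands D c)), arc_of D (right_under (strands D c))}" for c
  proof (rule word_eq_conjugate)
    show "([(arc_of D (left_under (strands D c)), True)],
        [(arc_of D (over_in (strands D c)), True), (arc_of D (right_under (strands D c)), True),
         (arc_of D (over_in (strands D c)), False)]) \<in> ?R"
      using that(1) by (auto simp: wirtinger_relation_def Let_def intro!: image_eqI[of _ _ c])
    show "arc_of D (left_under (strands D c)) \<in> ?X" "arc_of D (right_under (strands D c)) \<in> ?X"
      "arc_of D (over_in (strands D c)) \<in> ?X"
      using that(1) unfolding X
      by (auto simp: edges_def classical_def left_under_def right_under_def intro!: imageI)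
  qed (use that(2) in auto)
  have gX: "g \<in> ?X" by (auto simp: g_def X ed)
  have gg: "word_eq ?X ?R [(g, True)] [(g, True)]"
    using gX by (auto intro!: word_eq.refl simp: words_def)
  have "word_eq ?X ?R [(arc_of D e, True)] [(g, True)]" if "e \<in> edges D" for e
    using st
  proof
    assume s: "strands D = twist_strands 3"
    have a: "arc_of D Right_Tip = g" "arc_of D (Bot 0) = g" "arc_of D (Top (Suc 0)) = g"
      "arc_of D (Bot 2) = g" "arc_of D (Top 3) = g"
      using over[of "Twist 1"] over[of "Twist 2"] over[of "Twist 3"]
        over[of Upper_Clasp] over[of Lower_Clasp] under[of "Twist 1"] under[of "Twist 3"]
      by (simp_all add: cr s g_def)
    have b: "arc_of D (Top 0) = arc_of D (Bot (Suc 0))" "arc_of D (Top 2) = arc_of D (Bot 3)"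
      using over[of "Twist 1"] over[of "Twist 3"] by (simp_all add: cr s)
    have c: "word_eq ?X ?R [(arc_of D (Bot 3), True)] [(g, True)]"
      "word_eq ?X ?R [(g, True)] [(arc_of D (Bot (Suc 0)), True)]"
      using conj[of Upper_Clasp] conj[of Lower_Clasp]
      by (auto simp: cl s a b g_def[symmetric] left_under_def right_under_def intro: word_eq.sym)
    show ?thesis
      using that c gg unfolding ed by (auto simp: a b g_def[symmetric] intro: word_eq.sym)
  next
    assume s: "strands D = switch \<circ> twist_strands 3"
    have a: "arc_of D Right_Tip = g" "arc_of D (Top 0) = g" "arc_of D (Bot (Suc 0)) = g"
      "arc_of D (Top 2) = g" "arc_of D (Bot 3) = g"
      using over[of "Twist 1"] over[of "Twist 2"] over[of "Twist 3"]
        over[of Upper_Clasp] over[of Lower_Clasp] under[of "Twist 1"] under[of "Twist 3"]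
      by (simp_all add: cr s switch_def g_def)
    have b: "arc_of D (Top (Suc 0)) = arc_of D (Bot 0)" "arc_of D (Top 3) = arc_of D (Bot 2)"
      using under[of "Twist 1"] over[of "Twist 1"] under[of "Twist 3"] over[of "Twist 3"]
      by (simp_all add: cr s switch_def)
    have c: "word_eq ?X ?R [(arc_of D (Bot 0), True)] [(g, True)]"
      "word_eq ?X ?R [(arc_of D (Bot 2), True)] [(g, True)]"
      using conj[of Upper_Clasp] conj[of Lower_Clasp]
      by (auto simp: cl s a b switch_def g_def[symmetric] left_under_def right_under_def
          intro: word_eq.sym)
    show ?thesis
      using that c gg unfolding ed by (auto simp: a b g_def[symmetric] intro: word_eq.sym)
  qed
  then have "\<And>x. x \<in> ?X \<Longrightarrow> word_eq ?X ?R [(x, True)] [(g, True)]"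
    by (auto simp: X)
  from presented_group_infinite_cyclic[OF gX this exp_sum_wirtinger]
  show ?thesis by (simp add: knot_group_def D_def)
qed

end

theory Submission
  imports Defs "HOL-Number_Theory.Cong"
begin

text \<open>For odd \<open>n\<close> the diagram has a Fox colouring modulo \<open>2 n - 7\<close>: the group acts on the integers
  modulo \<open>2 n - 7\<close>, an arc coloured \<open>a\<close> acting as the reflection \<open>z \<mapsto> 2 a - z\<close>. The arcs through
  \<open>Bot 0\<close> and \<open>Top 0\<close> receive the colours \<open>0\<close> and \<open>1\<close>; the commutator of their reflections is the
  translation by \<open>\<plusminus>4\<close>, which is nontrivial since \<open>2 n - 7\<close> is odd and at least \<open>3\<close>. So the group is
  not abelian.\<close>

lemma presented_group_mult:
  assumes "u \<in> words X" "v \<in> words X"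
  shows "word_rel X R `` {u} \<otimes>\<^bsub>presented_group X R\<^esub> word_rel X R `` {v} = word_rel X R `` {u @ v}"
proof -
  have "word_eq X R (u @ v) w"
    if "word_eq X R u u'" "word_eq X R v v'" "word_eq X R (u' @ v') w" for u' v' w
    using word_eq.append[OF that(1,2)] that(3) by (rule word_eq.trans)
  moreover have "word_eq X R u u" "word_eq X R v v"
    using assms by (auto intro: word_eq.refl)
  ultimately show ?thesis
    unfolding presented_group_def word_rel_def by simp blast
qed

text \<open>Addition of integers commutes and an isomorphism is injective. A single pair of words
  that do not commute thus rules out an infinite cyclic group.\<close>

lemma word_eq_commute_if_infinite_cyclic:
  assumes "presented_group X R \<cong> integer_group" and u: "u \<in> words X" and v: "v \<in> words X"
  shows "word_eq X R (u @ v) (v @ u)"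
proof -
  let ?G = "presented_group X R" and ?c = "\<lambda>w. word_rel X R `` {w}"
  from assms(1) obtain h where h: "h \<in> iso ?G integer_group"
    by (auto simp: is_iso_def)
  have uv: "u @ v \<in> words X" "v @ u \<in> words X"
    using u v by (auto simp: words_def)
  have carrier: "?c w \<in> carrier ?G" if "w \<in> words X" for w
    using that by (simp add: presented_group_def quotientI)
  have hom: "h (?c (w @ w')) = h (?c w) + h (?c w')"
    if "w \<in> words X" "w' \<in> words X" for w w'
    using h carrier[OF that(1)] carrier[OF that(2)] that
    by (auto simp: iso_def hom_def presented_group_mult[symmetric])
  have "h (?c (u @ v)) = h (?c (v @ u))"
    using u v by (simp add: hom)
  then have "?c (u @ v) = ?c (v @ u)"
    using h carrier uv by (auto simp: iso_def bij_betw_def dest: inj_onD)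
  then have "(u @ v, v @ u) \<in> word_rel X R"
    using equiv_word_rel uv(2) by (rule eq_equiv_class)
  then show ?thesis by (simp add: word_rel_def)
qed

text \<open>A reflection is its own inverse, so the exponent \<open>b\<close> is ignored.\<close>

fun reflect :: "('g \<Rightarrow> int) \<Rightarrow> 'g word \<Rightarrow> int \<Rightarrow> int" where
  "reflect f [] z = z"
| "reflect f ((x, b) # w) z = 2 * f x - reflect f w z"

lemma reflect_append: "reflect f (u @ v) z = reflect f u (reflect f v z)"
  by (induction f u z rule: reflect.induct) auto

lemma reflect_cong: "[y = z] (mod N) \<Longrightarrow> [reflect f w y = reflect f w z] (mod N)"
  by (induction w) (auto intro: cong_diff[OF cong_refl])

text \<open>The action descends to the presented group: \<open>cancel\<close> holds because
  reflecting twice in the same point is the identity.\<close>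

lemma word_eq_reflect:
  assumes "word_eq X R u v"
    and "\<And>u v z. (u, v) \<in> R \<Longrightarrow> [reflect f u z = reflect f v z] (mod N)"
  shows "[reflect f u z = reflect f v z] (mod N)"
  using assms(1)
proof (induction arbitrary: z)
  case (append u u' v v')
  then show ?case
    by (metis cong_trans reflect_append reflect_cong)
qed (auto simp: assms(2) intro: cong_sym cong_trans)

text \<open>The classical condition is symmetric in the two under-edges, so signs and orientations
  drop out. Colouring edges instead of arcs makes every condition local to one crossing.\<close>

definition fox_coloring :: "('c, 'e) diagram \<Rightarrow> int \<Rightarrow> ('e \<Rightarrow> int) \<Rightarrow> bool"
  where "fox_coloring D N col \<longleftrightarrow> (\<forall>c\<in>crossings D.
    let s = strands D c in
      [col (over_in s) = col (over_out s)] (mod N) \<and>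
      (if c \<in> virtual D then [col (under_in s) = col (under_out s)] (mod N)
       else [col (under_in s) + col (under_out s) = 2 * col (over_in s)] (mod N)))"

lemma fox_coloring_arc:
  assumes "fox_coloring D N col" "f \<in> arc_of D e"
  shows "[col e = col f] (mod N)"
proof -
  have *: "[col e = col f] (mod N)" if "(e, f) \<in> joined D \<union> (joined D)\<inverse>" for e f
    using assms(1) that unfolding fox_coloring_def joined_def Let_def
    by (auto intro: cong_sym)
  from assms(2) have "(e, f) \<in> (joined D \<union> (joined D)\<inverse>)\<^sup>*"
    by (simp add: arc_of_def arc_rel_def)
  then show ?thesis
    by (induction rule: rtrancl_induct) (auto intro: cong_trans *)
qed

text \<open>Composing the reflections in two colours \<open>a\<close> and \<open>b\<close> gives the
  translations by \<open>2 * (a - b)\<close> and \<open>2 * (b - a)\<close>, depending on the order.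
  If they agree modulo \<open>N\<close>, then \<open>N\<close> divides
  \<open>4 * (a - b)\<close>.\<close>

lemma fox_coloring_not_infinite_cyclic:
  assumes col: "fox_coloring D N col" and "e \<in> edges D" "f \<in> edges D"
    and ne: "\<not> [4 * col e = 4 * col f] (mod N)"
  shows "\<not> knot_group D \<cong> integer_group"
proof
  assume "knot_group D \<cong> integer_group"
  let ?X = "arcs D" and ?R = "wirtinger_relation D ` classical D"
  \<comment> \<open>Edges of one arc have colours that are only congruent, so the colour of a chosen
    edge represents the arc.\<close>
  define g where "g A = col (SOME e. e \<in> A)" for A
  have g: "[g (arc_of D e) = col e] (mod N)" for e
  proof -
    have "e \<in> arc_of D e" by (simp add: arc_of_def arc_rel_def)
    then have "(SOME f. f \<in> arc_of D e) \<in> arc_of D e" by (rule someI)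
    from fox_coloring_arc[OF col this] show ?thesis by (simp add: g_def cong_sym)
  qed
  have rel: "[reflect g u z = reflect g v z] (mod N)" if uv: "(u, v) \<in> ?R" for u v z
  proof -
    from uv obtain c where c: "c \<in> classical D" "(u, v) = wirtinger_relation D c" by auto
    define s where "s = strands D c"
    let ?y = "arc_of D (over_in s)" and ?l = "arc_of D (left_under s)"
      and ?r = "arc_of D (right_under s)"
    have "[col (under_in s) + col (under_out s) = 2 * col (over_in s)] (mod N)"
      using c(1) col by (auto simp: fox_coloring_def classical_def Let_def s_def)
    then have "[col (left_under s) + col (right_under s) = 2 * col (over_in s)] (mod N)"
      by (simp add: left_under_def right_under_def add.commute)
    with g have "[g ?l + g ?r = 2 * g ?y] (mod N)"
      by (meson cong_add cong_scalar_left cong_sym cong_trans)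
    \<comment> \<open>At \<open>z\<close> the two sides of the relation take the values
      \<open>2 * g ?l - z\<close> and \<open>4 * g ?y - 2 * g ?r - z\<close>.\<close>
    from cong_scalar_left[OF this, of 2]
    have "[2 * (g ?l + g ?r) - (2 * g ?r + z) = 2 * (2 * g ?y) - (2 * g ?r + z)] (mod N)"
      by (intro cong_diff) auto
    with c(2) show ?thesis
      by (simp add: wirtinger_relation_def Let_def s_def algebra_simps)
  qed
  let ?a = "arc_of D e" and ?b = "arc_of D f"
  have "?a \<in> ?X" "?b \<in> ?X"
    using assms(2,3) by (auto simp: arcs_def arc_of_def quotient_def)
  then have "word_eq ?X ?R ([(?a, True)] @ [(?b, True)]) ([(?b, True)] @ [(?a, True)])"
    using \<open>knot_group D \<cong> integer_group\<close>
    by (intro word_eq_commute_if_infinite_cyclic) (auto simp: words_def knot_group_def)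
  from word_eq_reflect[OF this rel, of 0]
  have "[2 * g ?a - 2 * g ?b = 2 * g ?b - 2 * g ?a] (mod N)" by simp
  then have "[4 * g ?a = 4 * g ?b] (mod N)"
    by (simp add: cong_iff_dvd_diff algebra_simps)
  then have "[4 * col e = 4 * col f] (mod N)"
    using g by (meson cong_scalar_left cong_sym cong_trans)
  with ne show False ..
qed

text \<open>Both colourings start with \<open>Bot 0 \<mapsto> 0\<close>, \<open>Top 0 \<mapsto> 1\<close> and continue from left to right: a
  classical crossing carries the difference of the two colours along, a welded one exchanges the
  colours. The modulus is what it takes to close up at the clasp.\<close>

fun coloring :: "nat \<Rightarrow> twist_edge \<Rightarrow> int" where
  "coloring n (Bot i) =
    (if i + 2 \<le> n then int i else if i + 1 = n then int n - 3 else int n - 4)"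
| "coloring n (Top i) =
    (if i + 3 \<le> n then int i + 1 else if i + 1 = n then int n - 4 else int n - 3)"
| "coloring n Left_Tip = 0"
| "coloring n Right_Tip = int n - 3"

fun mirror_coloring :: "nat \<Rightarrow> twist_edge \<Rightarrow> int" where
  "mirror_coloring n (Bot i) =
    (if i + 3 \<le> n then - int i else if i + 1 = n then 5 - int n else 4 - int n)"
| "mirror_coloring n (Top i) =
    (if i + 2 \<le> n then 1 - int i else if i + 1 = n then 4 - int n else 5 - int n)"
| "mirror_coloring n Left_Tip = 1"
| "mirror_coloring n Right_Tip = 4 - int n"

text \<open>At all twist crossings the conditions hold as equations of integers. Only at the
  under-strands of the two clasp crossings do the sides differ, by \<open>2 * int n - 7\<close> up
  to sign.\<close>

lemma fox_coloring_welded_twist: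
  assumes "odd n" "n \<ge> 5"
  shows "fox_coloring (weld {Twist (n - 2), Twist n} (twist_diagram n)) (2 * int n - 7) (coloring n)"
    (is "fox_coloring ?D ?N ?col")
    and "fox_coloring (weld {Twist (n - 2), Twist n} (mirror_image (twist_diagram n)))
      (2 * int n - 7) (mirror_coloring n)" (is "fox_coloring ?D' ?N ?col'")
proof -
  obtain k where n: "n = Suc (Suc (Suc (Suc (Suc k))))" and k: "even k"
  proof
    show "n = Suc (Suc (Suc (Suc (Suc (n - 5)))))" "even (n - 5)"
      using assms by auto
  qed
  define cs where "cs = crossings (twist_diagram n)"
  \<comment> \<open>The crossings \<open>Twist (Suc j)\<close> lie to the left of both welded ones,
    where the colours are still linear in the index; the last three twist crossings are treated
    singly.\<close>
  have crossing: "(\<exists>j < k + 2. c = Twist (Suc j)) \<or> c = Twist (Suc (Suc (Suc k))) \<or>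
      c = Twist (Suc (Suc (Suc (Suc k)))) \<or> c = Twist n \<or> c = Upper_Clasp \<or> c = Lower_Clasp"
    if "c \<in> cs" for c
  proof -
    have "(\<exists>j < k + 2. i = Suc j) \<or> i = Suc (Suc (Suc k)) \<or> i = Suc (Suc (Suc (Suc k))) \<or> i = n"
      if "1 \<le> i" "i \<le> n" for i
      using that n by (cases i) auto
    moreover have "(\<exists>i. c = Twist i \<and> 1 \<le> i \<and> i \<le> n) \<or> c = Upper_Clasp \<or> c = Lower_Clasp"
      using that by (auto simp: cs_def twist_diagram_def)
    ultimately show ?thesis by blast
  qed
  \<comment> \<open>This is the modulus written in \<open>k\<close>; it serves the clasp condition
    whose sides differ by its negative.\<close>
  have dvd: "3 + int k * 2 dvd - 3 - int k * 2"
    by (rule dvdI[of _ _ "- 1"]) simp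
  have sets: "crossings ?D = cs" "crossings ?D' = cs" "virtual ?D = {Twist (n - 2), Twist n}"
    "virtual ?D' = {Twist (n - 2), Twist n}" "strands ?D = twist_strands n"
    "strands ?D' = switch \<circ> twist_strands n"
    by (simp_all add: cs_def weld_def twist_diagram_def mirror_image_def)
  show "fox_coloring ?D ?N ?col"
    unfolding fox_coloring_def sets Let_def
  proof
    fix c assume "c \<in> cs"
    from crossing[OF this] k dvd
    show "[?col (over_in (twist_strands n c)) = ?col (over_out (twist_strands n c))] (mod ?N) \<and>
      (if c \<in> {Twist (n - 2), Twist n}
       then [?col (under_in (twist_strands n c)) = ?col (under_out (twist_strands n c))] (mod ?N)
       else [?col (under_in (twist_strands n c)) + ?col (under_out (twist_strands n c)) =
         2 * ?col (over_in (twist_strands n c))] (mod ?N))"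
      by (elim disjE exE conjE) (auto simp: n cong_iff_dvd_diff algebra_simps)
  qed
  show "fox_coloring ?D' ?N ?col'"
    unfolding fox_coloring_def sets Let_def comp_def switch_def crossing.simps
  proof
    fix c assume "c \<in> cs"
    from crossing[OF this] k dvd
    show "[?col' (under_in (twist_strands n c)) = ?col' (under_out (twist_strands n c))] (mod ?N) \<and>
      (if c \<in> {Twist (n - 2), Twist n}
       then [?col' (over_in (twist_strands n c)) = ?col' (over_out (twist_strands n c))] (mod ?N)
       else [?col' (over_in (twist_strands n c)) + ?col' (over_out (twist_strands n c)) =
         2 * ?col' (under_in (twist_strands n c))] (mod ?N))"
      by (elim disjE exE conjE) (auto simp: n cong_iff_dvd_diff algebra_simps)
  qed
qed

theorem proposition4p5:
  fixes n :: nat and T :: "(twist_crossing, twist_edge) diagram"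
  assumes "T \<in> standard_twist_diagrams n"
    and "odd n" and "n \<ge> 5"
  shows "\<not> knot_group (weld {Twist (n - 2), Twist n} T) \<cong> integer_group"
proof -
  let ?D = "weld {Twist (n - 2), Twist n} T"
  obtain col where col: "fox_coloring ?D (2 * int n - 7) col" "col (Bot 0) = 0" "col (Top 0) = 1"
  proof -
    have "coloring n (Bot 0) = 0" "coloring n (Top 0) = 1"
      "mirror_coloring n (Bot 0) = 0" "mirror_coloring n (Top 0) = 1" using assms(3) by auto
    with assms that fox_coloring_welded_twist[OF assms(2,3)] show ?thesis
      by (auto simp: standard_twist_diagrams_def)
  qed
  have "strands T = twist_strands n \<or> strands T = switch \<circ> twist_strands n"
    "Twist 1 \<in> crossings T"
    using assms
    by (auto simp: standard_twist_diagrams_def twist_diagram_def mirror_image_def)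
  then have "Bot 0 \<in> edges ?D" "Top 0 \<in> edges ?D"
    by (auto simp: edges_def weld_def switch_def intro!: bexI[of _ "Twist 1"])
  moreover have "\<not> (2 * int n - 7) dvd 4"
  proof
    assume "(2 * int n - 7) dvd 4"
    \<comment> \<open>Writing 4 as a power of 2 reduces coprimality to the oddness of the
      modulus.\<close>
    moreover have "coprime (2 * int n - 7) (2 ^ 2)"
      unfolding coprime_power_right_iff by simp
    ultimately have "is_unit (2 * int n - 7)"
      by (intro coprime_common_divisor[of "2 * int n - 7" "2 ^ 2"]) auto
    then show False using assms(3) by auto
  qed
  ultimately show ?thesis
    using col by (intro fox_coloring_not_infinite_cyclic[of _ _ _ "Bot 0" "Top 0"])
      (auto simp: cong_iff_dvd_diff)
qed

end
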